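(* Let $\phi$ be a Drinfeld module of rank $r$ over $\mathbb{C}_\infty$ given by $\phi_T=T+\sum_{i=1}^rA_i\tau^i$, $A_r\ne0$, and write its logarithm as $\log_\phi(z)=\sum_{n=0}^\infty\beta_nz^{q^n}$. For $\mathbf{S}=(S_1,\dots,S_r)\in P_r(n)$ set \[L(\mathbf{S}):=\prod_{j=1}^r\prod_{i\in S_j}(-[i+j]).\] Then for all $n\ge0$, \[\beta_n=\sum_{\mathbf{S}\in P_r(n)}\frac{\mathbf{A}^{\mathbf{S}}}{L(\mathbf{S})}.\]
   Context: Let $q$ be a prime power, $\mathbb{A}=\mathbb{F}_q[T]$, $v$ the valuation with $v(T)=-1$, $\mathbb{C}_\infty$ the completion of an algebraic closure of the $v$-adic completion of $\mathbb{F}_q(T)$. A rank $r$ Drinfeld module $\phi$ is an $\mathbb{F}_q$-linear ring homomorphism $\mathbb{A}\to\mathbb{C}_\infty\{\tau\}$ ($\tau$ the $q$-Frobenius, $\tau\ell=\ell^q\tau$) with $\phi_T=T+\sum_{i=1}^rA_i\tau^i$, $A_r\neq 0$. Its exponential $e_\phi(z)=z+\sum_{n\ge1}\alpha_nz^{q^n}$ satisfies $e_\phi(Tz)=\phi_T(e_\phi(z))$, and its logarithm $\log_\phi(z)=\sum_{n\ge0}\beta_nz^{q^n}$ ($\beta_0=1$) is the composition inverse power series of $e_\phi$; it satisfies $T\log_\phi(z)=\log_\phi(\phi_T(z))$. Notation: $[n]:=T^{q^n}-T$; for finite $S\subset\mathbb{N}$, $w(S)=\sum_{i\in S}q^i$;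 for $\mathbf{S}=(S_1,\dots,S_r)$, $\mathbf{A}^{\mathbf{S}}=\prod_iA_i^{w(S_i)}$. For $n>0$, $P_r(n)$ is the set of $r$-tuples $(S_1,\dots,S_r)$ of subsets of $\{0,\dots,n-1\}$ such that the sets $S_i+j:=\{s+j:s\in S_i\}$, $1\le i\le r$, $0\le j\le i-1$, form a partition of $\{0,\dots,n-1\}$; $P_r(0)$ consists only of the tuple of empty sets. Empty products equal $1$. *)

theory Defs
  imports
    "HOL-Library.Extended_Real"
    "HOL-Library.Disjoint_Sets"
    "HOL-Library.FuncSet"
    "HOL-Library.Cardinality"
    "HOL-Computational_Algebra.Primes"
    "HOL-Computational_Algebra.Polynomial_Factorial"
    "HOL-Computational_Algebra.Formal_Power_Series"
begin

locale additive_valuation =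
  fixes v :: "'a :: field \<Rightarrow> ereal"
  assumes v_eq_infty_iff: "v x = \<infinity> \<longleftrightarrow> x = 0"
    and v_neq_minus_infty: "v x \<noteq> -\<infinity>"
    and v_mult: "v (x * y) = v x + v y"
    and v_add: "min (v x) (v y) \<le> v (x + y)"

definition v_Cauchy :: "('a :: field \<Rightarrow> ereal) \<Rightarrow> (nat \<Rightarrow> 'a) \<Rightarrow> bool" where
  "v_Cauchy v X \<longleftrightarrow> (\<forall>C::real. \<exists>N. \<forall>m\<ge>N. \<forall>n\<ge>N. ereal C < v (X m - X n))"

definition v_tendsto :: "('a :: field \<Rightarrow> ereal) \<Rightarrow> (nat \<Rightarrow> 'a) \<Rightarrow> 'a \<Rightarrow> bool" where
  "v_tendsto v X x \<longleftrightarrow> (\<lambda>n. v (X n - x)) \<longlonglongrightarrow> \<infinity>"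

definition is_completion :: "('a :: field \<Rightarrow> ereal) \<Rightarrow> 'a set \<Rightarrow> 'a set \<Rightarrow> bool" where
  "is_completion v K L \<longleftrightarrow>
     K \<subseteq> L \<and>
     (\<forall>x\<in>L. \<exists>X. range X \<subseteq> K \<and> v_tendsto v X x) \<and>
     (\<forall>X. range X \<subseteq> L \<and> v_Cauchy v X \<longrightarrow> (\<exists>x\<in>L. v_tendsto v X x))"

definition is_subfield :: "'a :: field set \<Rightarrow> bool" where
  "is_subfield L \<longleftrightarrow> 0 \<in> L \<and> 1 \<in> L \<and>
     (\<forall>x\<in>L. \<forall>y\<in>L. x - y \<in> L \<and> x * y \<in> L) \<and> (\<forall>x\<in>L. inverse x \<in> L)"

definition polys_over :: "'a :: field set \<Rightarrow> 'a poly set" where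
  "polys_over K = {p. \<forall>i. coeff p i \<in> K}"

definition is_algebraic_closure :: "'a :: field set \<Rightarrow> 'a set \<Rightarrow> bool" where
  "is_algebraic_closure K L \<longleftrightarrow>
     is_subfield L \<and> K \<subseteq> L \<and>
     (\<forall>x\<in>L. \<exists>p\<in>polys_over K. p \<noteq> 0 \<and> poly p x = 0) \<and>
     (\<forall>p\<in>polys_over L. degree p > 0 \<longrightarrow> (\<exists>x\<in>L. poly p x = 0))"

text \<open>
  A finite field \<open>\<F>\<^sub>q\<close> is given as a type \<open>'k\<close>, so \<open>q = CARD('k)\<close> and \<open>\<bbbA> = \<F>\<^sub>q[T]\<close> is \<open>'k poly\<close>.
  \<open>Tvar \<iota>\<close> and \<open>scalar \<iota> c\<close> are the images of \<open>T\<close> and of a constant \<open>c\<close> under an embedding \<open>\<iota>\<close>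
  of \<open>\<F>\<^sub>q(T)\<close>.
\<close>

definition Tvar :: "('k :: finite_field poly fract \<Rightarrow> 'a :: field) \<Rightarrow> 'a" where
  "Tvar \<iota> = \<iota> (to_fract [:0, 1:])"

definition scalar :: "('k :: finite_field poly fract \<Rightarrow> 'a :: field) \<Rightarrow> 'k \<Rightarrow> 'a" where
  "scalar \<iota> c = \<iota> (to_fract [:c:])"

text \<open>
  \<open>C_infinity v \<iota>\<close> says that the type \<open>'a\<close>, with the valuation \<open>v\<close> and the embedding \<open>\<iota>\<close>, is the
  completion of an algebraic closure of the completion of \<open>\<F>\<^sub>q(T)\<close> at the place where \<open>v(T) = -1\<close>.
  The intermediate fields are realised as subsets of \<open>'a\<close>.  This determines \<open>'a\<close> up to isometric
  isomorphism over \<open>\<F>\<^sub>q(T)\<close>.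
\<close>

locale C_infinity = additive_valuation v
  for v :: "'a :: field \<Rightarrow> ereal" +
  fixes \<iota> :: "'k :: finite_field poly fract \<Rightarrow> 'a"
  assumes emb_one: "\<iota> 1 = 1"
    and emb_add: "\<iota> (x + y) = \<iota> x + \<iota> y"
    and emb_mult: "\<iota> (x * y) = \<iota> x * \<iota> y"
    and v_T: "v (Tvar \<iota>) = -1"
    and completion_closure_completion:
      "\<exists>K_infty K_alg. is_completion v (range \<iota>) K_infty \<and>
         is_algebraic_closure K_infty K_alg \<and> is_completion v K_alg UNIV"

text \<open>
  An element \<open>\<Sum>\<^sub>i c\<^sub>i \<tau>\<^sup>i\<close> of the twisted polynomial ring \<open>'a{\<tau>}\<close> is represented by the ordinary
  polynomial with the coefficients \<open>c\<^sub>i\<close>; addition and scalars on the left are those of \<open>'a poly\<close>,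
  but the product is \<open>twisted_mult\<close>, in which \<open>\<tau>\<^sup>i c = c\<close>\<open>^\<close>\<open>(q\<^sup>i) \<tau>\<^sup>i\<close>.
\<close>

definition twisted_mult :: "nat \<Rightarrow> 'a :: field poly \<Rightarrow> 'a poly \<Rightarrow> 'a poly" where
  "twisted_mult q f g =
     (\<Sum>i\<le>degree f. \<Sum>j\<le>degree g. monom (coeff f i * coeff g j ^ (q ^ i)) (i + j))"

definition twisted_apply :: "nat \<Rightarrow> 'a :: field poly \<Rightarrow> 'a fps \<Rightarrow> 'a fps" where
  "twisted_apply q f F = (\<Sum>i\<le>degree f. fps_const (coeff f i) * F ^ (q ^ i))"

definition Fq_linear_ring_hom ::
  "('k :: finite_field poly fract \<Rightarrow> 'a :: field) \<Rightarrow> ('k poly \<Rightarrow> 'a poly) \<Rightarrow> bool" where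
  "Fq_linear_ring_hom \<iota> \<phi> \<longleftrightarrow>
     \<phi> 1 = 1 \<and>
     (\<forall>a b. \<phi> (a + b) = \<phi> a + \<phi> b) \<and>
     (\<forall>a b. \<phi> (a * b) = twisted_mult CARD('k) (\<phi> a) (\<phi> b)) \<and>
     (\<forall>c a. \<phi> (smult c a) = smult (scalar \<iota> c) (\<phi> a))"

text \<open>
  The coefficients are a function \<open>A\<close> of which only the values \<open>A 1, \<dots>, A r\<close> matter.
\<close>

definition drinfeld_module ::
  "('k :: finite_field poly fract \<Rightarrow> 'a :: field) \<Rightarrow> nat \<Rightarrow> (nat \<Rightarrow> 'a) \<Rightarrow> ('k poly \<Rightarrow> 'a poly) \<Rightarrow> bool"
where
  "drinfeld_module \<iota> r A \<phi> \<longleftrightarrow>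
     r \<ge> 1 \<and> Fq_linear_ring_hom \<iota> \<phi> \<and>
     \<phi> [:0, 1:] = [:Tvar \<iota>:] + (\<Sum>i=1..r. monom (A i) i) \<and> A r \<noteq> 0"

text \<open>
  The power series \<open>\<Sum>\<^sub>n \<alpha>\<^sub>n z\<close>\<open>^\<close>\<open>(q\<^sup>n)\<close>; for \<open>q \<ge> 2\<close> the index set of the inner sum has at most one
  element.
\<close>

definition q_series :: "nat \<Rightarrow> (nat \<Rightarrow> 'a :: field) \<Rightarrow> 'a fps" where
  "q_series q \<alpha> = Abs_fps (\<lambda>m. \<Sum>n | q ^ n = m. \<alpha> n)"

text \<open>
  The exponential is taken as a formal power series.  It exists and is unique
  (\<open>drinfeld_exp_ex1\<close> below), and its compositional inverse is again of the form
  \<open>q_series q \<beta>\<close> (\<open>drinfeld_log_q_series\<close> below).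
\<close>

definition is_drinfeld_exp ::
  "('k :: finite_field poly fract \<Rightarrow> 'a :: field) \<Rightarrow> ('k poly \<Rightarrow> 'a poly) \<Rightarrow> 'a fps \<Rightarrow> bool" where
  "is_drinfeld_exp \<iota> \<phi> e \<longleftrightarrow>
     (\<exists>\<alpha>. \<alpha> 0 = 1 \<and> e = q_series CARD('k) \<alpha>) \<and>
     e oo (fps_const (Tvar \<iota>) * fps_X) = twisted_apply CARD('k) (\<phi> [:0, 1:]) e"

definition drinfeld_exp ::
  "('k :: finite_field poly fract \<Rightarrow> 'a :: field) \<Rightarrow> ('k poly \<Rightarrow> 'a poly) \<Rightarrow> 'a fps" where
  "drinfeld_exp \<iota> \<phi> = (THE e. is_drinfeld_exp \<iota> \<phi> e)"

definition drinfeld_log ::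
  "('k :: finite_field poly fract \<Rightarrow> 'a :: field) \<Rightarrow> ('k poly \<Rightarrow> 'a poly) \<Rightarrow> 'a fps" where
  "drinfeld_log \<iota> \<phi> = fps_inv (drinfeld_exp \<iota> \<phi>)"

text \<open>
  The sets \<open>S\<^sub>i + j\<close> partition \<open>{0, \<dots>, n-1}\<close> as an indexed family: members may be empty, but two
  members with different indices \<open>(i, j)\<close> must be disjoint.  For \<open>n = 0\<close> only the tuple of empty
  sets remains, see \<open>shadowed_partitions_0\<close> below.
\<close>

definition shadowed_partitions :: "nat \<Rightarrow> nat \<Rightarrow> (nat \<Rightarrow> nat set) set" where
  "shadowed_partitions r n =
     {S \<in> {1..r} \<rightarrow>\<^sub>E Pow {0..<n}.
        disjoint_family_on (\<lambda>(i, j). (\<lambda>s. s + j) ` S i) (SIGMA i:{1..r}. {0..i-1}) \<and>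
        (\<Union>(i, j)\<in>(SIGMA i:{1..r}. {0..i-1}). (\<lambda>s. s + j) ` S i) = {0..<n}}"

definition weight :: "nat \<Rightarrow> nat set \<Rightarrow> nat" where
  "weight q S = (\<Sum>i\<in>S. q ^ i)"

definition coeff_power :: "nat \<Rightarrow> nat \<Rightarrow> (nat \<Rightarrow> 'a :: field) \<Rightarrow> (nat \<Rightarrow> nat set) \<Rightarrow> 'a" where
  "coeff_power q r A S = (\<Prod>i=1..r. A i ^ weight q (S i))"

definition bracket :: "('k :: finite_field poly fract \<Rightarrow> 'a :: field) \<Rightarrow> nat \<Rightarrow> 'a" where
  "bracket \<iota> n = Tvar \<iota> ^ (CARD('k) ^ n) - Tvar \<iota>"

definition L_prod ::
  "('k :: finite_field poly fract \<Rightarrow> 'a :: field) \<Rightarrow> nat \<Rightarrow> (nat \<Rightarrow> nat set) \<Rightarrow> 'a" where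
  "L_prod \<iota> r S = (\<Prod>j=1..r. \<Prod>i\<in>S j. - bracket \<iota> (i + j))"

lemma shadowed_partitions_0: "shadowed_partitions r 0 = {\<lambda>i\<in>{1..r}. {}}"
proof -
  have "{1..r} \<rightarrow>\<^sub>E Pow {0..<0::nat} = {\<lambda>i\<in>{1..r}. {}}"
    by (auto simp: PiE_iff extensional_def restrict_def fun_eq_iff)
  thus ?thesis
    by (auto simp: shadowed_partitions_def disjoint_family_on_def)
qed

unbundle fps_syntax

lemma q_series_nth: "q \<ge> 2 \<Longrightarrow> q_series q \<alpha> $ (q ^ n) = \<alpha> n"
proof -
  assume "q \<ge> 2"
  hence "{k. q ^ k = q ^ n} = {n}" by (auto dest: power_inject_exp[THEN iffD1, rotated])
  thus ?thesis by (simp add: q_series_def)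
qed

lemma q_series_nth_0: "(\<And>n. m \<noteq> q ^ n) \<Longrightarrow> q_series q \<alpha> $ m = 0"
proof -
  assume "\<And>n. m \<noteq> q ^ n"
  hence *: "{n. q ^ n = m} = {}" by (auto simp: eq_commute)
  show ?thesis unfolding q_series_def by (simp add: *)
qed

lemma fps_eq_q_seriesI:
  assumes "q \<ge> 2" "\<And>n. f $ (q ^ n) = \<alpha> n" "\<And>m. (\<And>n. m \<noteq> q ^ n) \<Longrightarrow> f $ m = 0"
  shows "f = q_series q \<alpha>"
proof (rule fps_ext)
  fix m
  show "f $ m = q_series q \<alpha> $ m"
    using assms by (cases "\<exists>n. m = q ^ n") (auto simp: q_series_nth q_series_nth_0)
qed

lemma q_series_inject: "q \<ge> 2 \<Longrightarrow> q_series q \<alpha> = q_series q \<beta> \<longleftrightarrow> \<alpha> = \<beta>"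
  by (metis ext q_series_nth)

lemma finite_field_card_binomial:
  assumes "0 < k" "k < CARD('k :: finite_field)"
  shows "of_nat (CARD('k) choose k) = (0 :: 'k)"
proof -
  define q where "q = CARD('k)"
  define P :: "'k poly" where "P = [:1, 1:] ^ q - monom 1 q - 1"
  have q: "q > 0" using assms by (simp add: q_def)
  have co: "coeff ([:1, 1:] ^ q :: 'k poly) i = of_nat (q choose i)" if "i \<le> q" for i
    using that by (simp add: coeff_linear_poly_power)
  have "P = 0"
  proof (rule ccontr)
    assume "P \<noteq> 0"
    have "coeff P i = 0" if "i \<ge> q" for i
      using that q degree_power_le[of "[:1, 1 :: 'k:]" q]
      by (cases "i = q") (auto simp: P_def co coeff_1 coeff_eq_0)
    hence "degree P < q" using \<open>P \<noteq> 0\<close> by (metis leI leading_coeff_0_iff)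
    moreover have "poly P x = 0" for x
      using finite_field_power_card_eq_same[of x] finite_field_power_card_eq_same[of "1 + x"]
      by (simp add: P_def poly_monom poly_power q_def)
    hence "{x. poly P x = 0} = UNIV" by auto
    hence "q \<le> degree P"
      using card_poly_roots_bound[OF \<open>P \<noteq> 0\<close>] by (simp add: q_def)
    ultimately show False by simp
  qed
  hence "coeff P k = 0" by simp
  thus ?thesis using assms by (simp add: P_def co coeff_1 q_def[symmetric])
qed

lemma q_power_add:
  fixes x y :: "'b :: comm_semiring_1"
  assumes "\<And>k. 0 < k \<Longrightarrow> k < q \<Longrightarrow> of_nat (q choose k) = (0 :: 'b)" "q > 0"
  shows "(x + y) ^ q ^ n = x ^ q ^ n + y ^ q ^ n"
proof -
  have *: "(x + y) ^ q = x ^ q + y ^ q" for x y :: 'b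
  proof -
    have "(x + y) ^ q = (\<Sum>k\<le>q. of_nat (q choose k) * x ^ k * y ^ (q - k))"
      by (rule binomial_ring)
    also have "\<dots> = (\<Sum>k\<in>{0, q}. of_nat (q choose k) * x ^ k * y ^ (q - k))"
      by (rule sum.mono_neutral_right) (use assms in auto)
    finally show ?thesis using assms(2) by (simp add: add.commute)
  qed
  show ?thesis
    by (induction n arbitrary: x y) (simp_all add: * power_mult)
qed

locale q_char =
  fixes q :: nat and dummy :: "'a :: field itself"
  assumes q2: "q \<ge> 2"
    and binom: "\<And>k. 0 < k \<Longrightarrow> k < q \<Longrightarrow> of_nat (q choose k) = (0 :: 'a)"
begin

lemma fps_add_power: "(f + g) ^ q ^ n = f ^ q ^ n + (g ^ q ^ n :: 'a fps)"
  by (rule q_power_add) (use binom q2 in \<open>auto simp flip: fps_const_0_eq_0 fps_of_nat\<close>)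

lemma fps_q_power_nth:
  "((f :: 'a fps) ^ q ^ n) $ m = (if q ^ n dvd m then (f $ (m div q ^ n)) ^ q ^ n else 0)"
proof (induction m arbitrary: f rule: less_induct)
  case (less m)
  have Q: "q ^ n > 0" using q2 by simp
  have f: "f = fps_const (f $ 0) + fps_X * fps_shift 1 f"
    by (rule fps_ext) auto
  have "f ^ q ^ n = fps_const (f $ 0) ^ q ^ n + (fps_X * fps_shift 1 f) ^ q ^ n"
    by (subst f) (rule fps_add_power)
  also have "\<dots> = fps_const ((f $ 0) ^ q ^ n) + fps_X ^ q ^ n * fps_shift 1 f ^ q ^ n"
    by (simp add: fps_const_power power_mult_distrib)
  finally have eq: "(f ^ q ^ n) $ m = (if m = 0 then (f $ 0) ^ q ^ n else 0) +
      (if m < q ^ n then 0 else (fps_shift 1 f ^ q ^ n) $ (m - q ^ n))"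
    by (simp add: fps_X_power_mult_nth)
  show ?case
  proof (cases "m < q ^ n")
    case True
    thus ?thesis using eq Q by (auto dest: dvd_imp_le)
  next
    case False
    hence "m - q ^ n < m" "m > 0" using Q by linarith+
    moreover have "q ^ n dvd m - q ^ n \<longleftrightarrow> q ^ n dvd m"
      using False by (simp add: dvd_minus_self)
    moreover have "Suc ((m - q ^ n) div q ^ n) = m div q ^ n"
      using False Q by (simp add: le_div_geq)
    ultimately show ?thesis using eq less.IH False by simp
  qed
qed

lemma q_series_power:
  "(q_series q (\<alpha> :: nat \<Rightarrow> 'a)) ^ q ^ i = q_series q (\<lambda>n. if i \<le> n then \<alpha> (n - i) ^ q ^ i else 0)"
proof (rule fps_eq_q_seriesI[OF q2])
  fix n
  have "q ^ i dvd q ^ n \<longleftrightarrow> i \<le> n" using q2 by (simp add: dvd_power_iff_le)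
  moreover have "i \<le> n \<Longrightarrow> q ^ n div q ^ i = q ^ (n - i)" using q2 by (simp add: power_diff)
  ultimately show "(q_series q \<alpha> ^ q ^ i) $ (q ^ n) = (if i \<le> n then \<alpha> (n - i) ^ q ^ i else 0)"
    using q2 by (simp add: fps_q_power_nth q_series_nth)
next
  fix m assume m: "\<And>n. m \<noteq> q ^ n"
  have "q_series q \<alpha> $ (m div q ^ i) = 0" if "q ^ i dvd m"
    by (rule q_series_nth_0) (metis m that dvd_mult_div_cancel power_add)
  thus "(q_series q \<alpha> ^ q ^ i) $ m = 0"
    using q2 by (simp add: fps_q_power_nth)
qed

lemma q_series_compose:
  fixes \<alpha> \<beta> :: "nat \<Rightarrow> 'a"
  shows "q_series q \<beta> oo q_series q \<alpha> = q_series q (\<lambda>n. \<Sum>i\<le>n. \<beta> i * \<alpha> (n - i) ^ q ^ i)"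
proof -
  have less: "i < q ^ i" for i using q2 by (simp add: less_exp power_gt_expt)
  have *: "(q_series q \<beta> oo q_series q \<alpha>) $ m =
    (\<Sum>i | q ^ i \<le> m. \<beta> i * (q_series q \<alpha> ^ q ^ i) $ m)" for m
  proof -
    have inj: "inj_on ((^) q) A" for A :: "nat set"
      using q2 by (auto intro!: inj_onI dest: power_inject_exp[THEN iffD1, rotated])
    have "(q_series q \<beta> oo q_series q \<alpha>) $ m =
      (\<Sum>k\<in>{0..m}. q_series q \<beta> $ k * (q_series q \<alpha> ^ k) $ m)"
      by (simp add: fps_compose_nth)
    also have "\<dots> = (\<Sum>k\<in>(^) q ` {i. q ^ i \<le> m}. q_series q \<beta> $ k * (q_series q \<alpha> ^ k) $ m)"
      by (rule sum.mono_neutral_right) (auto intro!: q_series_nth_0)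
    also have "\<dots> = (\<Sum>i | q ^ i \<le> m. \<beta> i * (q_series q \<alpha> ^ q ^ i) $ m)"
      by (subst sum.reindex[OF inj]) (simp add: q_series_nth[OF q2])
    finally show ?thesis .
  qed
  show ?thesis
  proof (rule fps_eq_q_seriesI[OF q2])
    fix n
    have "{i. q ^ i \<le> q ^ n} = {..n}" using q2 by (auto simp: power_increasing_iff)
    thus "(q_series q \<beta> oo q_series q \<alpha>) $ (q ^ n) = (\<Sum>i\<le>n. \<beta> i * \<alpha> (n - i) ^ q ^ i)"
      unfolding * by (simp add: q_series_power q_series_nth[OF q2])
  next
    fix m assume "\<And>n. m \<noteq> q ^ n"
    thus "(q_series q \<beta> oo q_series q \<alpha>) $ m = 0"
      unfolding * by (simp add: q_series_power q_series_nth_0)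
  qed
qed

lemma twisted_apply_q_series:
  fixes \<alpha> :: "nat \<Rightarrow> 'a"
  shows "twisted_apply q f (q_series q \<alpha>) = q_series q (\<lambda>n. \<Sum>i\<le>n. coeff f i * \<alpha> (n - i) ^ q ^ i)"
proof (rule fps_eq_q_seriesI[OF q2])
  fix n
  have "twisted_apply q f (q_series q \<alpha>) $ (q ^ n) =
    (\<Sum>i\<in>{..degree f}. if i \<le> n then coeff f i * \<alpha> (n - i) ^ q ^ i else 0)"
    by (auto simp: twisted_apply_def q_series_power q_series_nth[OF q2] fps_sum_nth intro!: sum.cong)
  also have "\<dots> = (\<Sum>i\<in>{..n} \<inter> {..degree f}. coeff f i * \<alpha> (n - i) ^ q ^ i)"
    by (rule sum.mono_neutral_cong_right) auto
  also have "\<dots> = (\<Sum>i\<le>n. coeff f i * \<alpha> (n - i) ^ q ^ i)"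
    by (rule sum.mono_neutral_left) (auto intro: coeff_eq_0)
  finally show "twisted_apply q f (q_series q \<alpha>) $ (q ^ n) = \<dots>" .
next
  fix m assume "\<And>n. m \<noteq> q ^ n"
  thus "twisted_apply q f (q_series q \<alpha>) $ m = 0"
    by (simp add: twisted_apply_def q_series_power q_series_nth_0 fps_sum_nth)
qed

lemma q_series_compose_linear:
  fixes \<alpha> :: "nat \<Rightarrow> 'a"
  shows "q_series q \<alpha> oo (fps_const c * fps_X) = q_series q (\<lambda>n. c ^ q ^ n * \<alpha> n)"
  by (rule fps_eq_q_seriesI[OF q2])
     (simp_all add: fps_compose_linear q_series_nth[OF q2] q_series_nth_0)

end

context C_infinity
begin

lemma card_ge_2: "CARD('k) \<ge> 2"
proof -
  have "card {0, 1 :: 'k} \<le> CARD('k)" by (rule card_mono) auto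
  thus ?thesis by simp
qed

lemma emb_0: "\<iota> 0 = 0"
  using emb_add[of 0 0] by (metis add_0_right add_left_cancel)

lemma emb_of_nat: "\<iota> (of_nat n) = of_nat n"
  by (induction n) (simp_all add: emb_0 emb_add emb_one)

lemma q_char: "q_char TYPE('a) CARD('k)"
proof
  fix k assume "0 < k" "k < CARD('k)"
  hence "of_nat (CARD('k) choose k) = (0 :: 'k)" by (rule finite_field_card_binomial)
  hence "of_nat (CARD('k) choose k) = (0 :: 'k poly)" by (simp add: of_nat_poly)
  hence "to_fract (of_nat (CARD('k) choose k) :: 'k poly) = 0" by (metis to_fract_0)
  hence "of_nat (CARD('k) choose k) = (0 :: 'k poly fract)"
    by (simp add: to_fract_def of_nat_fract)
  thus "of_nat (CARD('k) choose k) = (0 :: 'a)" by (metis emb_0 emb_of_nat)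
qed (rule card_ge_2)

lemma v_one: "v 1 = 0"
  using v_mult[of 1 1] v_eq_infty_iff[of 1] v_neq_minus_infty[of 1] by (cases "v 1") auto

lemma v_T_power: "v (Tvar \<iota> ^ n) = - ereal (real n)"
  by (induction n) (simp_all add: v_one v_mult v_T zero_ereal_def one_ereal_def)

lemma bracket_nonzero: assumes "n > 0" shows "bracket \<iota> n \<noteq> 0"
proof
  assume "bracket \<iota> n = 0"
  hence "v (Tvar \<iota> ^ (CARD('k) ^ n)) = v (Tvar \<iota> ^ 1)" by (simp add: bracket_def)
  hence "real (CARD('k) ^ n) = real 1" unfolding v_T_power by simp
  hence "CARD('k) ^ n = 1" by (simp only: of_nat_eq_iff)
  thus False using assms card_ge_2 by simp
qed

fun exp_coeff :: "(nat \<Rightarrow> 'a) \<Rightarrow> nat \<Rightarrow> 'a" where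
  "exp_coeff c n = (if n = 0 then 1 else
     (\<Sum>i\<in>{0<..n}. if i \<in> {0<..n} then c i * exp_coeff c (n - i) ^ CARD('k) ^ i else 0) / bracket \<iota> n)"

declare exp_coeff.simps [simp del]

lemma drinfeld_exp_ex1:
  assumes "drinfeld_module \<iota> r A \<phi>"
  shows "\<exists>!e. is_drinfeld_exp \<iota> \<phi> e"
proof -
  interpret q_char "CARD('k)" "TYPE('a)" by (rule q_char)
  define f where "f = \<phi> [:0, 1:]"
  have f0: "coeff f 0 = Tvar \<iota>"
    using assms by (simp add: drinfeld_module_def f_def coeff_sum)
  have iff: "(q_series CARD('k) \<alpha> oo (fps_const (Tvar \<iota>) * fps_X) =
      twisted_apply CARD('k) f (q_series CARD('k) \<alpha>)) \<longleftrightarrow>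
    (\<forall>n. bracket \<iota> n * \<alpha> n = (\<Sum>i\<in>{0<..n}. coeff f i * \<alpha> (n - i) ^ CARD('k) ^ i))" for \<alpha>
  proof -
    have "(\<Sum>i\<le>n. coeff f i * \<alpha> (n - i) ^ CARD('k) ^ i) =
      Tvar \<iota> * \<alpha> n + (\<Sum>i\<in>{0<..n}. coeff f i * \<alpha> (n - i) ^ CARD('k) ^ i)" for n
    proof -
      have "{..n} = insert 0 {0<..n}" by auto
      thus ?thesis by (simp add: f0)
    qed
    thus ?thesis
      unfolding q_series_compose_linear twisted_apply_q_series q_series_inject[OF q2] fun_eq_iff
      by (simp add: bracket_def algebra_simps)
  qed
  define \<alpha> where "\<alpha> = exp_coeff (coeff f)"
  have \<alpha>0: "\<alpha> 0 = 1" by (simp add: \<alpha>_def exp_coeff.simps)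
  have \<alpha>: "bracket \<iota> n * \<alpha> n = (\<Sum>i\<in>{0<..n}. coeff f i * \<alpha> (n - i) ^ CARD('k) ^ i)" for n
  proof (cases "n = 0")
    case True
    thus ?thesis by (simp add: bracket_def)
  next
    case False
    hence "\<alpha> n = (\<Sum>i\<in>{0<..n}. coeff f i * \<alpha> (n - i) ^ CARD('k) ^ i) / bracket \<iota> n"
      unfolding \<alpha>_def by (subst exp_coeff.simps) simp
    thus ?thesis using bracket_nonzero[of n] False by simp
  qed
  show ?thesis
  proof (rule ex1I)
    show "is_drinfeld_exp \<iota> \<phi> (q_series CARD('k) \<alpha>)"
      using \<alpha> \<alpha>0 iff unfolding is_drinfeld_exp_def f_def by blast
  next
    fix e assume "is_drinfeld_exp \<iota> \<phi> e"
    then obtain \<gamma> where \<gamma>: "\<gamma> 0 = 1" "e = q_series CARD('k) \<gamma>"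
      "\<And>n. bracket \<iota> n * \<gamma> n = (\<Sum>i\<in>{0<..n}. coeff f i * \<gamma> (n - i) ^ CARD('k) ^ i)"
      unfolding is_drinfeld_exp_def f_def[symmetric] using iff by blast
    have "\<gamma> n = \<alpha> n" for n
    proof (induction n rule: less_induct)
      case (less n)
      show ?case
      proof (cases "n = 0")
        case False
        have "bracket \<iota> n * \<gamma> n = bracket \<iota> n * \<alpha> n"
          unfolding \<alpha> \<gamma>(3) by (intro sum.cong) (use less in auto)
        thus ?thesis using bracket_nonzero[of n] False by simp
      qed (simp add: \<alpha>0 \<gamma>)
    qed
    thus "e = q_series CARD('k) \<alpha>" using \<gamma>(2) by presburger
  qed
qed

lemma drinfeld_exp:
  "drinfeld_module \<iota> r A \<phi> \<Longrightarrow> is_drinfeld_exp \<iota> \<phi> (drinfeld_exp \<iota> \<phi>)"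
  unfolding drinfeld_exp_def by (rule theI') (rule drinfeld_exp_ex1)

lemma drinfeld_log_q_series:
  assumes "drinfeld_module \<iota> r A \<phi>"
  shows "\<exists>!\<beta>. drinfeld_log \<iota> \<phi> = q_series CARD('k) \<beta>"
proof -
  interpret q_char "CARD('k)" "TYPE('a)" by (rule q_char)
  from drinfeld_exp[OF assms] obtain \<alpha>
    where \<alpha>: "\<alpha> 0 = 1" "drinfeld_exp \<iota> \<phi> = q_series CARD('k) \<alpha>"
    unfolding is_drinfeld_exp_def by blast
  let ?e = "q_series CARD('k) \<alpha>"
  have e1: "?e $ 1 = 1" using q_series_nth[OF q2, of \<alpha> 0] \<alpha>(1) by simp
  have e0: "?e $ 0 = 0" by (rule q_series_nth_0) (use q2 in auto)
  define \<beta> where "\<beta> n = fps_inv ?e $ (CARD('k) ^ n)" for n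
  have "\<exists>\<gamma>. \<forall>n. (\<Sum>i\<le>n. \<gamma> i * \<alpha> (n - i) ^ CARD('k) ^ i) = (if n = 0 then 1 else 0)"
  proof -
    define \<gamma> where "\<gamma> = wfrec less_than (\<lambda>g n. (if n = 0 then 1 else 0) -
      (\<Sum>i<n. g i * \<alpha> (n - i) ^ CARD('k) ^ i))"
    have \<gamma>: "\<gamma> n = (if n = 0 then 1 else 0) - (\<Sum>i<n. \<gamma> i * \<alpha> (n - i) ^ CARD('k) ^ i)" for n
      unfolding \<gamma>_def by (subst wfrec) (auto simp: cut_apply)
    have "(\<Sum>i\<le>n. \<gamma> i * \<alpha> (n - i) ^ CARD('k) ^ i) = (if n = 0 then 1 else 0)" for n
      by (simp add: lessThan_Suc_atMost[symmetric] \<gamma>[of n] \<alpha>(1))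
    thus ?thesis by blast
  qed
  then obtain \<gamma> where \<gamma>: "\<And>n. (\<Sum>i\<le>n. \<gamma> i * \<alpha> (n - i) ^ CARD('k) ^ i) = (if n = 0 then 1 else 0)"
    by blast
  have "q_series CARD('k) \<gamma> oo ?e = fps_X"
    unfolding q_series_compose \<gamma>
  proof (rule sym, rule fps_eq_q_seriesI[OF q2])
    fix n
    have "CARD('k) ^ n = 1 \<longleftrightarrow> n = 0" using q2 by auto
    thus "fps_X $ (CARD('k) ^ n) = (if n = 0 then 1 else 0 :: 'a)" by simp
  next
    fix m assume "\<And>n. m \<noteq> CARD('k) ^ n"
    from this[of 0] show "fps_X $ m = (0 :: 'a)" by simp
  qed
  hence "q_series CARD('k) \<gamma> oo ?e = fps_inv ?e oo ?e"
    using e0 e1 by (simp add: fps_inv)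
  hence "q_series CARD('k) \<gamma> = fps_inv ?e"
    using fps_compose_inj_right[OF e0] e1 by simp
  hence "drinfeld_log \<iota> \<phi> = q_series CARD('k) \<gamma>"
    by (simp add: drinfeld_log_def \<alpha>(2))
  thus ?thesis using q_series_inject[OF q2] by metis
qed

end

end

theory Submission
  imports Defs
begin

text \<open>
  Comparing coefficients in \<open>T log(z) = log(\<phi>\<^sub>T(z))\<close> gives
  \<open>-[n] \<beta>\<^sub>n = \<Sum>\<^sub>i A\<^sub>i\<close>\<open>^\<close>\<open>(q\<^bsup>n-i\<^esup>) \<beta>\<^bsub>n-i\<^esub>\<close>.  A shadowed partition is a tiling of \<open>{0, \<dots>, n-1}\<close> by
  intervals \<open>{s, \<dots>, s+i-1}\<close> with \<open>s \<in> S\<^sub>i\<close>; removing the tile that contains \<open>n-1\<close>, which is the one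
  with \<open>s = n-i\<close>, shows that the right-hand side satisfies the same recursion.
\<close>

section \<open>Shadowed partitions as interval tilings\<close>

text \<open>An element \<open>s\<close> of \<open>S i\<close> stands for the tile of cells
  \<open>s + j\<close> with \<open>j < i\<close>. For a fixed cell \<open>x\<close>, index pairs
  \<open>(i, j)\<close> and tiles \<open>(i, s)\<close> through \<open>x\<close> correspond via
  \<open>j = x - s\<close>, so disjointness of the family becomes uniqueness of the tile covering
  \<open>x\<close>. The two inclusions of the union condition become the bound and the covering
  condition.\<close>

lemma shadowed_partitions_iff:
  "S \<in> shadowed_partitions r n \<longleftrightarrow>
     S \<in> extensional {1..r} \<and> (\<forall>i\<in>{1..r}. \<forall>s\<in>S i. s + i \<le> n) \<and>
     (\<forall>x<n. \<exists>i\<in>{1..r}. \<exists>s\<in>S i. s \<le> x \<and> x < s + i) \<and>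
     (\<forall>x. \<forall>i\<in>{1..r}. \<forall>s\<in>S i. \<forall>i'\<in>{1..r}. \<forall>s'\<in>S i'.
        s \<le> x \<longrightarrow> x < s + i \<longrightarrow> s' \<le> x \<longrightarrow> x < s' + i' \<longrightarrow> i = i' \<and> s = s')"
  (is "?L \<longleftrightarrow> ?E \<and> ?B \<and> ?C \<and> ?U")
proof
  assume L: ?L
  have un: "(\<Union>(i, j)\<in>(SIGMA i:{1..r}. {0..i-1}). (\<lambda>s. s + j) ` S i) = {0..<n}"
    using L by (simp add: shadowed_partitions_def)
  have dis: "disjoint_family_on (\<lambda>(i, j). (\<lambda>s. s + j) ` S i) (SIGMA i:{1..r}. {0..i-1})"
    using L by (simp add: shadowed_partitions_def)
  have ?E using L by (simp add: shadowed_partitions_def PiE_def)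
  moreover have ?B
  proof (intro ballI)
    fix i s assume *: "i \<in> {1..r}" "s \<in> S i"
    \<comment> \<open>The offset \<open>i - 1\<close> picks the last cell of the tile; since
      \<open>i >= 1\<close>, its lying below \<open>n\<close> means
      \<open>s + i <= n\<close>.\<close>
    hence "s + (i - 1) \<in> (\<Union>(i, j)\<in>(SIGMA i:{1..r}. {0..i-1}). (\<lambda>s. s + j) ` S i)"
      by (intro UN_I[of "(i, i - 1)"]) auto
    hence "s + (i - 1) < n" unfolding un by simp
    thus "s + i \<le> n" using * by auto
  qed
  moreover have ?C
  proof (intro allI impI)
    fix x assume "x < n"
    hence "x \<in> (\<Union>(i, j)\<in>(SIGMA i:{1..r}. {0..i-1}). (\<lambda>s. s + j) ` S i)" unfolding un by simp
    then obtain i j s where *: "i \<in> {1..r}" "j \<le> i - 1" "s \<in> S i" "x = s + j" by auto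
    thus "\<exists>i\<in>{1..r}. \<exists>s\<in>S i. s \<le> x \<and> x < s + i"
      by (intro bexI[of _ i] bexI[of _ s]) auto
  qed
  moreover have ?U
  proof (intro allI ballI impI)
    fix x i s i' s'
    assume *: "i \<in> {1..r}" "s \<in> S i" "i' \<in> {1..r}" "s' \<in> S i'"
      "s \<le> x" "x < s + i" "s' \<le> x" "x < s' + i'"
    have "x \<in> (\<lambda>t. t + (x - s)) ` S i \<inter> (\<lambda>t. t + (x - s')) ` S i'"
      using * by (auto intro: image_eqI[of _ _ s] image_eqI[of _ _ s'])
    moreover have "(i, x - s) \<in> (SIGMA i:{1..r}. {0..i-1})" "(i', x - s') \<in> (SIGMA i:{1..r}. {0..i-1})"
      using * by auto
    ultimately have "(i, x - s) = (i', x - s')"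
      using dis unfolding disjoint_family_on_def by blast
    thus "i = i' \<and> s = s'" using * by auto
  qed
  ultimately show "?E \<and> ?B \<and> ?C \<and> ?U" by blast
next
  assume R: "?E \<and> ?B \<and> ?C \<and> ?U"
  have bound: "s + i \<le> n" if "i \<in> {1..r}" "s \<in> S i" for i s
    using R that by blast
  have "S i \<subseteq> {0..<n}" if "i \<in> {1..r}" for i
    using bound[OF that] that by fastforce
  hence "S \<in> {1..r} \<rightarrow>\<^sub>E Pow {0..<n}" using conjunct1[OF R] by (simp add: PiE_def Pi_def)
  moreover have "disjoint_family_on (\<lambda>(i, j). (\<lambda>s. s + j) ` S i) (SIGMA i:{1..r}. {0..i-1})"
    unfolding disjoint_family_on_def
  proof (intro ballI impI)
    fix p p' assume "p \<in> (SIGMA i:{1..r}. {0..i-1})" "p' \<in> (SIGMA i:{1..r}. {0..i-1})" "p \<noteq> p'"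
    then obtain i j i' j' where p: "p = (i, j)" "p' = (i', j')" and
      *: "i \<in> {1..r}" "j \<in> {0..i-1}" "i' \<in> {1..r}" "j' \<in> {0..i'-1}" "\<not> (i = i' \<and> j = j')"
      by blast
    have False if "s \<in> S i" "s' \<in> S i'" "s + j = s' + j'" for s s'
    proof -
      have "s \<le> s + j" "s + j < s + i" "s' \<le> s + j" "s + j < s' + i'" using * that by auto
      hence "i = i' \<and> s = s'" using R *(1,3) that(1,2) by blast
      thus False using * that by simp
    qed
    thus "(case p of (i, j) \<Rightarrow> (\<lambda>s. s + j) ` S i) \<inter> (case p' of (i, j) \<Rightarrow> (\<lambda>s. s + j) ` S i) = {}"
      unfolding p by auto
  qed
  moreover have "(\<Union>(i, j)\<in>(SIGMA i:{1..r}. {0..i-1}). (\<lambda>s. s + j) ` S i) = {0..<n}"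
  proof
    show "(\<Union>(i, j)\<in>(SIGMA i:{1..r}. {0..i-1}). (\<lambda>s. s + j) ` S i) \<subseteq> {0..<n}"
      using bound by fastforce
    show "{0..<n} \<subseteq> (\<Union>(i, j)\<in>(SIGMA i:{1..r}. {0..i-1}). (\<lambda>s. s + j) ` S i)"
    proof
      fix x assume "x \<in> {0..<n}"
      then obtain i s where *: "i \<in> {1..r}" "s \<in> S i" "s \<le> x" "x < s + i"
        using R by (meson atLeastLessThan_iff)
      thus "x \<in> (\<Union>(i, j)\<in>(SIGMA i:{1..r}. {0..i-1}). (\<lambda>s. s + j) ` S i)"
        by (intro UN_I[of "(i, x - s)"]) (auto intro: image_eqI[of _ _ s])
    qed
  qed
  ultimately show ?L by (simp add: shadowed_partitions_def)
qed

lemma shadowed_partitionsD: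
  assumes "S \<in> shadowed_partitions r n"
  shows shadowed_partitions_extensional: "S \<in> extensional {1..r}"
    and shadowed_partitions_bound: "\<And>i s. i \<in> {1..r} \<Longrightarrow> s \<in> S i \<Longrightarrow> s + i \<le> n"
  using assms unfolding shadowed_partitions_iff by blast+

lemma shadowed_partitions_unique:
  assumes "S \<in> shadowed_partitions r n"
    and "i \<in> {1..r}" "s \<in> S i" "s \<le> x" "x < s + i"
    and "i' \<in> {1..r}" "s' \<in> S i'" "s' \<le> x" "x < s' + i'"
  shows "i = i' \<and> s = s'"
  using assms unfolding shadowed_partitions_iff by blast

lemma shadowed_partitions_cover:
  assumes "S \<in> shadowed_partitions r n" "x < n"
  obtains i s where "i \<in> {1..r}" "s \<in> S i" "s \<le> x" "x < s + i"
  using assms unfolding shadowed_partitions_iff by blast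

lemma shadowed_partitionsI:
  assumes "S \<in> extensional {1..r}"
    and "\<And>i s. i \<in> {1..r} \<Longrightarrow> s \<in> S i \<Longrightarrow> s + i \<le> n"
    and "\<And>x. x < n \<Longrightarrow> \<exists>i\<in>{1..r}. \<exists>s\<in>S i. s \<le> x \<and> x < s + i"
    and "\<And>i s i' s' x. i \<in> {1..r} \<Longrightarrow> s \<in> S i \<Longrightarrow> s \<le> x \<Longrightarrow> x < s + i \<Longrightarrow>
           i' \<in> {1..r} \<Longrightarrow> s' \<in> S i' \<Longrightarrow> s' \<le> x \<Longrightarrow> x < s' + i' \<Longrightarrow> i = i' \<and> s = s'"
  shows "S \<in> shadowed_partitions r n"
  unfolding shadowed_partitions_iff using assms by blast

lemma finite_shadowed_partitions: "finite (shadowed_partitions r n)"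
  by (rule finite_subset[of _ "{1..r} \<rightarrow>\<^sub>E Pow {0..<n}"])
     (auto simp: shadowed_partitions_def intro!: finite_PiE)

section \<open>Placing and removing the last tile\<close>

text \<open>All tiles of \<open>S\<close> end at or before \<open>m\<close>, so a tile of length
  \<open>i\<close> starting at \<open>m\<close> overlaps none of them and covers exactly the new
  cells.\<close>

lemma shadowed_partitions_insert:
  assumes S: "S \<in> shadowed_partitions r m" and i: "i \<in> {1..r}"
  shows "S(i := insert m (S i)) \<in> shadowed_partitions r (m + i)"
proof (rule shadowed_partitionsI)
  show "S(i := insert m (S i)) \<in> extensional {1..r}"
    using shadowed_partitions_extensional[OF S] i by (auto simp: extensional_def)
  show "s + k \<le> m + i" if "k \<in> {1..r}" "s \<in> (S(i := insert m (S i))) k" for k s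
    using shadowed_partitions_bound[OF S, of k s] that by (auto split: if_splits)
  show "\<exists>k\<in>{1..r}. \<exists>s\<in>(S(i := insert m (S i))) k. s \<le> x \<and> x < s + k" if "x < m + i" for x
  proof (cases "x < m")
    case True
    from shadowed_partitions_cover[OF S this] show ?thesis
      by (metis fun_upd_apply insertI2)
  next
    case False
    thus ?thesis using that i by (intro bexI[of _ i] bexI[of _ m]) auto
  qed
  show "k = k' \<and> s = s'"
    if "k \<in> {1..r}" "s \<in> (S(i := insert m (S i))) k" "s \<le> x" "x < s + k"
       "k' \<in> {1..r}" "s' \<in> (S(i := insert m (S i))) k'" "s' \<le> x" "x < s' + k'" for k s k' s' x
    using shadowed_partitions_unique[OF S, of k s x k' s']
      shadowed_partitions_bound[OF S, of k s] shadowed_partitions_bound[OF S, of k' s'] that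
    by (auto split: if_splits)
qed

text \<open>The tile at \<open>m\<close> occupies every cell from \<open>m\<close> on, which
  confines all other tiles to the cells below \<open>m\<close>.\<close>

lemma shadowed_partitions_remove:
  assumes S: "S \<in> shadowed_partitions r (m + i)" and i: "i \<in> {1..r}" and m: "m \<in> S i"
  shows "S(i := S i - {m}) \<in> shadowed_partitions r m"
proof (rule shadowed_partitionsI)
  show "S(i := S i - {m}) \<in> extensional {1..r}"
    using shadowed_partitions_extensional[OF S] i by (auto simp: extensional_def)
  show "s + k \<le> m" if k: "k \<in> {1..r}" and s: "s \<in> (S(i := S i - {m})) k" for k s
  proof (rule ccontr)
    assume "\<not> s + k \<le> m"
    moreover have s': "s \<in> S k" using s by (auto split: if_splits)
    \<comment> \<open>The last cell \<open>s + k - 1\<close> of a tile reaching beyond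
      \<open>m\<close> also lies in the tile at \<open>m\<close>, so the two coincide.\<close>
    ultimately have "k = i \<and> s = m"
      using shadowed_partitions_bound[OF S k s'] i k m
      by (intro shadowed_partitions_unique[OF S, of _ _ "s + k - 1"]) auto
    thus False using s by simp
  qed
  show "\<exists>k\<in>{1..r}. \<exists>s\<in>(S(i := S i - {m})) k. s \<le> x \<and> x < s + k" if "x < m" for x
  proof -
    from that have "x < m + i" by simp
    from shadowed_partitions_cover[OF S this]
    obtain k s where *: "k \<in> {1..r}" "s \<in> S k" "s \<le> x" "x < s + k" .
    \<comment> \<open>A tile covering \<open>x < m\<close> starts before \<open>m\<close>, so it is
      not the removed one.\<close>
    thus ?thesis using that by (intro bexI[of _ k] bexI[of _ s]) auto
  qed
  show "k = k' \<and> s = s'"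
    if "k \<in> {1..r}" "s \<in> (S(i := S i - {m})) k" "s \<le> x" "x < s + k"
       "k' \<in> {1..r}" "s' \<in> (S(i := S i - {m})) k'" "s' \<le> x" "x < s' + k'" for k s k' s' x
    using shadowed_partitions_unique[OF S, of k s x k' s'] that by (auto split: if_splits)
qed

text \<open>Such a tile would end beyond \<open>m\<close>. Inserting \<open>m\<close> therefore adds
  a new element, as both injectivity and the product formulas require.\<close>

lemma shadowed_partitions_notin:
  "S \<in> shadowed_partitions r m \<Longrightarrow> i \<in> {1..r} \<Longrightarrow> m \<notin> S i"
  using shadowed_partitions_bound[of S r m i m] by auto

text \<open>The tile containing \<open>n - 1\<close> ends at \<open>n\<close>, so its length
  \<open>i\<close> determines its start. The range up to \<open>min r n\<close> makes
  \<open>n - i\<close> a true difference.\<close>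

lemma shadowed_partitions_bij_betw:
  assumes "n > 0"
  shows "bij_betw (\<lambda>(i, S). S(i := insert (n - i) (S i)))
           (SIGMA i:{1..min r n}. shadowed_partitions r (n - i)) (shadowed_partitions r n)"
  (is "bij_betw ?f ?D ?P")
proof (rule bij_betw_imageI)
  have ins: "S(i := insert (n - i) (S i)) \<in> ?P"
    if "i \<in> {1..min r n}" "S \<in> shadowed_partitions r (n - i)" for i S
    using shadowed_partitions_insert[of S r "n - i" i] that by simp
  show "inj_on ?f ?D"
  proof (rule inj_onI, clarify)
    fix i S i' S'
    assume *: "i \<in> {1..min r n}" "S \<in> shadowed_partitions r (n - i)"
      "i' \<in> {1..min r n}" "S' \<in> shadowed_partitions r (n - i')"
      and eq: "S(i := insert (n - i) (S i)) = S'(i' := insert (n - i') (S' i'))" (is "?R = ?R'")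
    have "n - i \<in> ?R i" by simp
    moreover have "n - i' \<in> ?R i'" by (subst eq) simp
    \<comment> \<open>Both tiles cover \<open>n - 1\<close> in one and the same tiling.\<close>
    ultimately have ii: "i = i'"
      using shadowed_partitions_unique[OF ins[OF *(1,2)], of i "n - i" "n - 1" i' "n - i'"] * assms
      by auto
    \<comment> \<open>\<open>insert\<close> can be cancelled because the element is absent on both
      sides.\<close>
    have "n - i \<notin> S i" "n - i \<notin> S' i"
      using shadowed_partitions_notin[of _ r "n - i" i] * ii by auto
    hence "S i = S' i"
      using fun_cong[OF eq, of i] ii by (auto dest: insert_ident)
    moreover have "S k = S' k" if "k \<noteq> i" for k
      using fun_cong[OF eq, of k] ii that by simp
    ultimately show "i = i' \<and> S = S'" using ii by (metis ext)
  qed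
  show "?f ` ?D = ?P"
  proof
    show "?f ` ?D \<subseteq> ?P" using ins by auto
    show "?P \<subseteq> ?f ` ?D"
    proof
      fix S assume S: "S \<in> ?P"
      from assms have "n - 1 < n" by simp
      from shadowed_partitions_cover[OF S this]
      obtain i s where mem: "i \<in> {1..r}" "s \<in> S i" "s \<le> n - 1" "n - 1 < s + i" .
      \<comment> \<open>The tile covers \<open>n - 1\<close> and ends by \<open>n\<close>, hence
        ends exactly at \<open>n\<close>.\<close>
      hence n: "n = s + i" using shadowed_partitions_bound[OF S mem(1,2)] by simp
      have "S(i := S i - {s}) \<in> shadowed_partitions r (n - i)"
        using shadowed_partitions_remove[of S r s i] S mem n by simp
      hence "(i, S(i := S i - {s})) \<in> ?D" using mem n by simp
      moreover have "S = ?f (i, S(i := S i - {s}))"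
        using mem n by (auto simp: fun_eq_iff)
      ultimately show "S \<in> ?f ` ?D" by blast
    qed
  qed
qed

section \<open>The recursion for the sum over shadowed partitions\<close>

lemma coeff_power_insert:
  assumes "i \<in> {1..r}" "m \<notin> S i" "finite (S i)"
  shows "coeff_power q r A (S(i := insert m (S i))) = A i ^ q ^ m * coeff_power q r A S"
proof -
  have "(\<Prod>k\<in>{1..r} - {i}. A k ^ weight q ((S(i := insert m (S i))) k)) =
      (\<Prod>k\<in>{1..r} - {i}. A k ^ weight q (S k))"
    by (rule prod.cong) auto
  thus ?thesis using assms
    by (simp add: coeff_power_def prod.remove[of "{1..r}" i] weight_def power_add
             del: fun_upd_apply One_nat_def add: fun_upd_same)
qed

text \<open>For the last tile \<open>m = n - i\<close>, so the new factor is
  \<open>- bracket \<iota> n\<close> whatever the length \<open>i\<close>; this common denominator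
  can be pulled out of the whole sum.\<close>

lemma L_prod_insert:
  assumes "i \<in> {1..r}" "m \<notin> S i" "finite (S i)"
  shows "L_prod \<iota> r (S(i := insert m (S i))) = - bracket \<iota> (m + i) * L_prod \<iota> r S"
proof -
  have "(\<Prod>k\<in>{1..r} - {i}. \<Prod>s\<in>(S(i := insert m (S i))) k. - bracket \<iota> (s + k)) =
      (\<Prod>k\<in>{1..r} - {i}. \<Prod>s\<in>S k. - bracket \<iota> (s + k))"
    by (rule prod.cong) auto
  thus ?thesis using assms
    by (simp add: L_prod_def prod.remove[of "{1..r}" i] del: fun_upd_apply One_nat_def add: fun_upd_same)
qed

text \<open>The tilings are grouped by the length of their last tile.\<close>

lemma shadowed_partitions_sum_rec:
  assumes "n > 0"
  shows "(\<Sum>S\<in>shadowed_partitions r n. coeff_power q r A S / L_prod \<iota> r S) =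
    (\<Sum>i\<in>{1..min r n}. A i ^ q ^ (n - i) *
      (\<Sum>S\<in>shadowed_partitions r (n - i). coeff_power q r A S / L_prod \<iota> r S)) / - bracket \<iota> n"
  (is "?l = ?r")
proof -
  let ?g = "\<lambda>S. coeff_power q r A S / L_prod \<iota> r S"
  have "?l = (\<Sum>(i, S)\<in>(SIGMA i:{1..min r n}. shadowed_partitions r (n - i)).
      ?g (S(i := insert (n - i) (S i))))"
    by (subst sum.reindex_bij_betw[OF shadowed_partitions_bij_betw[OF assms], symmetric])
       (simp add: case_prod_unfold)
  also have "\<dots> = (\<Sum>i\<in>{1..min r n}. \<Sum>S\<in>shadowed_partitions r (n - i).
      ?g (S(i := insert (n - i) (S i))))"
    by (rule sum.Sigma[symmetric]) (auto simp: finite_shadowed_partitions)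
  also have "\<dots> = (\<Sum>i\<in>{1..min r n}. \<Sum>S\<in>shadowed_partitions r (n - i).
      A i ^ q ^ (n - i) * ?g S / - bracket \<iota> n)"
  proof (intro sum.cong refl)
    fix i S assume i: "i \<in> {1..min r n}" and S: "S \<in> shadowed_partitions r (n - i)"
    have i': "i \<in> {1..r}" using i by simp
    have "S i \<subseteq> {..n}" using shadowed_partitions_bound[OF S i'] by fastforce
    hence fin: "finite (S i)" by (rule finite_subset) simp
    show "?g (S(i := insert (n - i) (S i))) = A i ^ q ^ (n - i) * ?g S / - bracket \<iota> n"
      unfolding coeff_power_insert[of i r "n - i" S, OF i' shadowed_partitions_notin[OF S i'] fin]
        L_prod_insert[of i r "n - i" S, OF i' shadowed_partitions_notin[OF S i'] fin]
      using i by (simp add: mult.commute)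
  qed
  also have "\<dots> = ?r"
    by (simp add: sum_divide_distrib sum_distrib_left sum_negf)
  finally show ?thesis .
qed

section \<open>The recursion for the coefficients of the logarithm\<close>

context C_infinity
begin

text \<open>The exponential has constant coefficient 0 and linear coefficient 1, so
  \<open>fps_inv\<close> yields a genuine left inverse.\<close>

lemma drinfeld_log_compose_exp:
  assumes "drinfeld_module \<iota> r A \<phi>"
  shows "drinfeld_log \<iota> \<phi> oo drinfeld_exp \<iota> \<phi> = fps_X"
proof -
  interpret q_char "CARD('k)" "TYPE('a)" by (rule q_char)
  from drinfeld_exp[OF assms] obtain \<alpha>
    where \<alpha>: "\<alpha> 0 = 1" "drinfeld_exp \<iota> \<phi> = q_series CARD('k) \<alpha>"
    unfolding is_drinfeld_exp_def by blast
  have "q_series CARD('k) \<alpha> $ 1 = 1" using q_series_nth[OF q2, of \<alpha> 0] \<alpha>(1) by simp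
  moreover have "q_series CARD('k) \<alpha> $ 0 = 0" by (rule q_series_nth_0) (use q2 in auto)
  ultimately show ?thesis by (simp add: drinfeld_log_def \<alpha>(2) fps_inv)
qed

text \<open>The inner \<open>q_series\<close> is the additive polynomial attached to the image of T.
  Composed with the exponential on the right, both sides become T times the variable, and the
  exponential can be cancelled.\<close>

lemma drinfeld_log_functional_equation:
  assumes "drinfeld_module \<iota> r A \<phi>"
  shows "drinfeld_log \<iota> \<phi> oo q_series CARD('k) (coeff (\<phi> [:0, 1:])) =
    fps_const (Tvar \<iota>) * drinfeld_log \<iota> \<phi>"
proof -
  interpret q_char "CARD('k)" "TYPE('a)" by (rule q_char)
  let ?f = "\<phi> [:0, 1:]" and ?l = "drinfeld_log \<iota> \<phi>" and ?e = "drinfeld_exp \<iota> \<phi>"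
  from drinfeld_exp[OF assms] obtain \<alpha> where \<alpha>: "\<alpha> 0 = 1" "?e = q_series CARD('k) \<alpha>"
    and eq: "?e oo (fps_const (Tvar \<iota>) * fps_X) = twisted_apply CARD('k) ?f ?e"
    unfolding is_drinfeld_exp_def by blast
  have nth_0: "q_series CARD('k) \<gamma> $ 0 = 0" for \<gamma> :: "nat \<Rightarrow> 'a"
    by (rule q_series_nth_0) (use q2 in auto)
  have e0: "?e $ 0 = 0" by (simp add: \<alpha>(2) nth_0)
  have e1: "?e $ 1 \<noteq> 0" using q_series_nth[OF q2, of \<alpha> 0] \<alpha> by simp
  have "(?l oo q_series CARD('k) (coeff ?f)) oo ?e = ?l oo (q_series CARD('k) (coeff ?f) oo ?e)"
    by (simp add: fps_compose_assoc e0 nth_0)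
  \<comment> \<open>Substituting the exponential into the additive polynomial is the twisted action
    on it.\<close>
  also have "q_series CARD('k) (coeff ?f) oo ?e = twisted_apply CARD('k) ?f ?e"
    by (simp add: \<alpha>(2) q_series_compose twisted_apply_q_series)
  also have "?l oo \<dots> = ?l oo ?e oo (fps_const (Tvar \<iota>) * fps_X)"
    unfolding eq[symmetric] by (rule fps_compose_assoc) (simp_all add: e0)
  also have "\<dots> = fps_const (Tvar \<iota>) * fps_X"
    by (simp add: drinfeld_log_compose_exp[OF assms])
  also have "\<dots> = (fps_const (Tvar \<iota>) * ?l) oo ?e"
    by (simp add: fps_compose_mult_distrib e0 drinfeld_log_compose_exp[OF assms])
  finally show ?thesis using fps_compose_inj_right[OF e0] e1 by simp
qed

lemma drinfeld_log_coeff_0: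
  assumes "drinfeld_module \<iota> r A \<phi>" "drinfeld_log \<iota> \<phi> = q_series CARD('k) \<beta>"
  shows "\<beta> 0 = 1"
proof -
  interpret q_char "CARD('k)" "TYPE('a)" by (rule q_char)
  from drinfeld_exp[OF assms(1)] obtain \<alpha>
    where \<alpha>: "\<alpha> 0 = 1" "drinfeld_exp \<iota> \<phi> = q_series CARD('k) \<alpha>"
    unfolding is_drinfeld_exp_def by blast
  have "(q_series CARD('k) \<beta> oo q_series CARD('k) \<alpha>) $ (CARD('k) ^ 0) = fps_X $ 1"
    using drinfeld_log_compose_exp[OF assms(1)] by (simp add: assms(2) \<alpha>(2))
  thus ?thesis by (simp only: q_series_compose q_series_nth[OF q2]) (simp add: \<alpha>(1))
qed

text \<open>In the functional equation, the coefficients at exponent \<open>CARD('k) ^ n\<close>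
  contain \<open>\<beta> n\<close> on both sides; collecting these terms produces the factor
  \<open>- bracket \<iota> n\<close>, nonzero for \<open>n > 0\<close>.\<close>

lemma drinfeld_log_coeff_rec:
  assumes D: "drinfeld_module \<iota> r A \<phi>" "drinfeld_log \<iota> \<phi> = q_series CARD('k) \<beta>" and n: "n > 0"
  shows "\<beta> n = (\<Sum>i\<in>{1..min r n}. A i ^ CARD('k) ^ (n - i) * \<beta> (n - i)) / - bracket \<iota> n"
proof -
  interpret q_char "CARD('k)" "TYPE('a)" by (rule q_char)
  define f where "f = \<phi> [:0, 1:]"
  \<comment> \<open>Beyond \<open>r\<close> the coefficients vanish, whatever values
    \<open>A\<close> takes there.\<close>
  have f: "coeff f i = (if i = 0 then Tvar \<iota> else if i \<le> r then A i else 0)" for i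
    using D(1) by (cases i) (auto simp: drinfeld_module_def f_def coeff_sum)
  have "(q_series CARD('k) \<beta> oo q_series CARD('k) (coeff f)) $ (CARD('k) ^ n) =
      (fps_const (Tvar \<iota>) * q_series CARD('k) \<beta>) $ (CARD('k) ^ n)"
    using drinfeld_log_functional_equation[OF D(1)] unfolding D(2) f_def by simp
  hence "(\<Sum>i\<le>n. \<beta> i * coeff f (n - i) ^ CARD('k) ^ i) = Tvar \<iota> * \<beta> n"
    by (simp add: q_series_compose q_series_nth[OF q2])
  \<comment> \<open>The sum is reversed so that its index becomes the exponent of tau, matching the
    tile length.\<close>
  also have "(\<Sum>i\<le>n. \<beta> i * coeff f (n - i) ^ CARD('k) ^ i) =
      (\<Sum>i\<le>n. \<beta> (n - i) * coeff f i ^ CARD('k) ^ (n - i))"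
    by (rule sum.reindex_bij_witness[of _ "\<lambda>i. n - i" "\<lambda>i. n - i"]) auto
  also have "\<dots> = \<beta> n * Tvar \<iota> ^ CARD('k) ^ n +
      (\<Sum>i\<in>{1..n}. \<beta> (n - i) * coeff f i ^ CARD('k) ^ (n - i))"
  proof -
    have "{..n} = insert 0 {1..n}" by auto
    thus ?thesis by (simp add: f)
  qed
  also have "(\<Sum>i\<in>{1..n}. \<beta> (n - i) * coeff f i ^ CARD('k) ^ (n - i)) =
      (\<Sum>i\<in>{1..min r n}. A i ^ CARD('k) ^ (n - i) * \<beta> (n - i))"
    by (rule sum.mono_neutral_cong_right) (auto simp: f)
  finally show ?thesis using bracket_nonzero[OF n] by (simp add: bracket_def field_simps)
qed

end

theorem theorem3p3:
  fixes v :: "'a :: field \<Rightarrow> ereal"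
    and \<iota> :: "'k :: finite_field poly fract \<Rightarrow> 'a"
    and q r :: nat
    and A \<beta> :: "nat \<Rightarrow> 'a"
    and \<phi> :: "'k poly \<Rightarrow> 'a poly"
  assumes "C_infinity v \<iota>"
    and "q = CARD('k)"
    and "drinfeld_module \<iota> r A \<phi>"
    and "drinfeld_log \<iota> \<phi> = q_series q \<beta>"
  shows "\<forall>n. \<beta> n = (\<Sum>S\<in>shadowed_partitions r n. coeff_power q r A S / L_prod \<iota> r S)"
proof
  interpret C_infinity v \<iota> by (rule assms(1))
  note log = assms(3) assms(4)[unfolded assms(2)]
  fix n
  show "\<beta> n = (\<Sum>S\<in>shadowed_partitions r n. coeff_power q r A S / L_prod \<iota> r S)"
  proof (induction n rule: less_induct)
    case (less n)
    show ?case
    proof (cases "n = 0")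
      case True
      thus ?thesis using drinfeld_log_coeff_0[OF log]
        by (simp add: shadowed_partitions_0 coeff_power_def L_prod_def weight_def)
    next
      case False
      hence n: "n > 0" by simp
      \<comment> \<open>Every \<open>i\<close> here is at least 1, so the induction hypothesis
        applies at \<open>n - i\<close>.\<close>
      have "(\<Sum>i\<in>{1..min r n}. A i ^ q ^ (n - i) * \<beta> (n - i)) =
        (\<Sum>i\<in>{1..min r n}. A i ^ q ^ (n - i) *
          (\<Sum>S\<in>shadowed_partitions r (n - i). coeff_power q r A S / L_prod \<iota> r S))"
        by (intro sum.cong refl arg_cong2[of _ _ _ _ "(*)"] less.IH) auto
      thus ?thesis
        unfolding shadowed_partitions_sum_rec[OF n] drinfeld_log_coeff_rec[OF log n] assms(2)[symmetric]
        by (rule arg_cong)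
    qed
  qed
qed

end
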